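(* Let $G$ be a Hausdorff topological group. Then $G$ is amenable if and only if the following holds: for every $\theta \in [0,1)$, every finite subset $E \subseteq G$, and every finite uniform covering $\mathcal{U}$ of $G_{r}$, there exists a finite non-empty subset $F \subseteq G$ such that $$\forall g \in E \colon \quad \mu(F,gF,\mathcal{U}) \geq \theta |F| .$$
   Context: Right uniformity: $G_r$ denotes $G$ with its right uniformity. A set $\mathcal{U}$ of subsets of $G$ is a uniform covering of $G_r$ if there is a neighborhood $U$ of the neutral element such that for every $x\in G$ the set $Ux$ is contained in some member of $\mathcal{U}$. A function $f\colon G\to\mathbb{R}$ is uniformly continuous on $G_r$ if for every $\epsilon>0$ there is an identity neighborhood $U$ with $|f(x)-f(y)|\le\epsilon$ whenever $xy^{-1}\in U$; ${\rm UC}_b(G_r)$ is the space of bounded such functions. Amenability: a mean on $G_r$ is a linear map $\nu\colon {\rm UC}_b(G_r)\to\mathbb{R}$ with $\inf_{x\in G} f(x)\le\nu(f)\le\sup_{x\in G} f(x)$ for all $f$. Put $\lambda_G(g)(x)=gx$. The topological group $G$ is amenable if there is a mean $\nu$ on $G_r$ with $\nu(f\circ\lambda_G(g))=\nu(f)$ for all $f\in{\rm UC}_b(G_r)$ and $g\in G$. Matching number: for a covering $\mathcal{U}$ of a set $X$ and finite $E,F\subseteq X$, $\mu(E,F,\mathcal{U})$ is the maximal cardinality of the domain $D\subseteq E$ of an injective map $\phi\colon D\to F$ such that for every $x\in D$ there is $U\in\mathcal{U}$ with $\{x,\phi(x)\}\subseteq U$. *)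

theory Defs
  imports "HOL-Analysis.Analysis"
begin

text \<open>
  The library's class of not necessarily commutative topological groups,
  \<^class>\<open>topological_group_add\<close>, is written additively: the product \<open>xy\<close> is \<open>x + y\<close>,
  the neutral element is \<open>0\<close>, and \<open>xy\<inverse>\<close> is \<open>x - y\<close>. The order of summands matters.
\<close>

definition right_uniform_covering :: "'a::topological_group_add set set \<Rightarrow> bool" where
  "right_uniform_covering \<U> \<longleftrightarrow>
     (\<exists>U. 0 \<in> interior U \<and> (\<forall>x. \<exists>V\<in>\<U>. (\<lambda>u. u + x) ` U \<subseteq> V))"

text \<open>
  \<^class>\<open>topological_group_add\<close> carries no uniform structure, so uniform continuity
  with respect to the right uniformity is spelled out.
\<close>

definition right_uniformly_continuous :: "('a::topological_group_add \<Rightarrow> real) \<Rightarrow> bool" where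
  "right_uniformly_continuous f \<longleftrightarrow>
     (\<forall>\<epsilon>>0. \<exists>U. 0 \<in> interior U \<and> (\<forall>x y. x - y \<in> U \<longrightarrow> \<bar>f x - f y\<bar> \<le> \<epsilon>))"

definition UCb_right :: "('a::topological_group_add \<Rightarrow> real) set" where
  "UCb_right = {f. right_uniformly_continuous f \<and> bounded (range f)}"

text \<open>
  A functional on \<^const>\<open>UCb_right\<close> is represented by a total function whose values
  outside \<^const>\<open>UCb_right\<close> are irrelevant; \<^const>\<open>UCb_right\<close> is closed under the
  pointwise vector space operations.
\<close>

definition mean_right :: "(('a::topological_group_add \<Rightarrow> real) \<Rightarrow> real) \<Rightarrow> bool" where
  "mean_right \<nu> \<longleftrightarrow>
     (\<forall>f\<in>UCb_right. \<forall>h\<in>UCb_right. \<nu> (\<lambda>x. f x + h x) = \<nu> f + \<nu> h) \<and>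
     (\<forall>c. \<forall>f\<in>UCb_right. \<nu> (\<lambda>x. c * f x) = c * \<nu> f) \<and>
     (\<forall>f\<in>UCb_right. (INF x. f x) \<le> \<nu> f \<and> \<nu> f \<le> (SUP x. f x))"

definition amenable :: "'a::topological_group_add itself \<Rightarrow> bool" where
  "amenable _ \<longleftrightarrow>
     (\<exists>\<nu> :: ('a \<Rightarrow> real) \<Rightarrow> real. mean_right \<nu> \<and>
        (\<forall>f\<in>UCb_right. \<forall>g. \<nu> (f \<circ> (\<lambda>x. g + x)) = \<nu> f))"

definition matching_number :: "'a set \<Rightarrow> 'a set \<Rightarrow> 'a set set \<Rightarrow> nat" where
  "matching_number E F \<U> =
     Max {card D |D. D \<subseteq> E \<and>
            (\<exists>\<phi>. inj_on \<phi> D \<and> \<phi> ` D \<subseteq> F \<and> (\<forall>x\<in>D. \<exists>U\<in>\<U>. {x, \<phi> x} \<subseteq> U))}"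

end

theory Submission
  imports Defs
begin

text \<open>
  From the matching condition to amenability, the mean is a limit of uniform averages over finite
  sets. Finitely many functions in \<^const>\<open>UCb_right\<close> vary little on the members of a suitable finite
  uniform covering, namely a covering by joint level sets. If a large part of \<open>F\<close> is matched into
  \<open>g + F\<close> along this covering, then the averages of such a function over \<open>F\<close> and over \<open>g + F\<close>
  almost agree. The means form a compact set in the topology of pointwise convergence, so the
  approximately invariant means obtained in this way have a limit point, which is invariant
  (\<open>amenable_if_matching_condition\<close>).

  Conversely, let \<open>\<nu>\<close> be an invariant mean and \<open>\<U>\<close> a finite uniform covering. If \<open>G\<close> is finite, take
  \<open>F = G\<close>. Otherwise, by a Urysohn lemma for the right uniformity (\<open>uniform_Urysohn\<close>), every
  subfamily \<open>I\<close> of \<open>\<U>\<close> has a uniformly continuous function \<open>q\<^sub>I\<close> with values in \<open>[0,1]\<close> that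
  vanishes outside \<open>\<Union>I\<close> and is \<open>1\<close> at every point all of whose members of \<open>\<U>\<close> belong to \<open>I\<close>.
  Suppose that the sums of each \<open>q\<^sub>I\<close> over \<open>F\<close> and over \<open>g + F\<close> differ by at most \<open>\<epsilon>|F|\<close>. For
  \<open>S \<subseteq> F\<close> let \<open>I\<close> consist of the members of \<open>\<U>\<close> that meet \<open>S\<close>. Then
  \<open>|S| \<le> \<Sum>\<^sub>F q\<^sub>I \<le> \<Sum>\<^sub>g\<^sub>+\<^sub>F q\<^sub>I + \<epsilon>|F|\<close>, and the last sum is at most the number of elements of \<open>g + F\<close>
  that share a member of \<open>\<U>\<close> with an element of \<open>S\<close>. This is Hall's condition with defect
  \<open>\<epsilon>|F|\<close>, so all but \<open>\<epsilon>|F|\<close> elements of \<open>F\<close> can be matched (\<open>matching_with_defect\<close>).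

  It remains to find \<open>F\<close>. The finitely many functions \<open>k(x) = q\<^sub>I(g + x) - q\<^sub>I(x)\<close> have
  \<open>\<nu>\<close>-mean zero, and so does every linear combination of them; a function of mean zero is below \<open>1\<close>
  at infinitely many points (\<open>infinite_below_one_if_mean_zero\<close>). The elements of \<open>F\<close> are therefore
  chosen greedily and distinct: a new point is taken where the combination whose coefficients are
  the sums collected so far is below \<open>1\<close>. The squared length of the vector of these sums then
  grows only linearly in \<open>|F|\<close>, so each sum is \<open>O(sqrt |F|)\<close> (\<open>balanced_set_exists\<close>).
\<close>

section \<open>Bounded uniformly continuous functions and means\<close>

lemma UCb_right_const: "(\<lambda>_. c) \<in> UCb_right"
  unfolding UCb_right_def right_uniformly_continuous_def by (auto intro: exI[of _ UNIV])

lemma UCb_right_bound: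
  assumes "f \<in> UCb_right"
  obtains B where "B > 0" "\<And>x. \<bar>f x\<bar> \<le> B"
  using assms unfolding UCb_right_def bounded_pos by auto

lemma UCb_right_add:
  assumes "f \<in> UCb_right" "h \<in> UCb_right"
  shows "(\<lambda>x. f x + h x) \<in> UCb_right"
proof -
  have "right_uniformly_continuous (\<lambda>x. f x + h x)"
    unfolding right_uniformly_continuous_def
  proof (intro allI impI)
    fix \<epsilon> :: real assume "\<epsilon> > 0"
    then have "\<epsilon> / 2 > 0" by simp
    then obtain U V where U: "0 \<in> interior U" "\<And>x y. x - y \<in> U \<Longrightarrow> \<bar>f x - f y\<bar> \<le> \<epsilon> / 2"
      and V: "0 \<in> interior V" "\<And>x y. x - y \<in> V \<Longrightarrow> \<bar>h x - h y\<bar> \<le> \<epsilon> / 2"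
      using assms unfolding UCb_right_def right_uniformly_continuous_def by blast
    have "\<bar>f x + h x - (f y + h y)\<bar> \<le> \<epsilon>" if "x - y \<in> U \<inter> V" for x y
    proof -
      have "\<bar>f x - f y\<bar> \<le> \<epsilon> / 2" "\<bar>h x - h y\<bar> \<le> \<epsilon> / 2"
        using U(2) V(2) that by auto
      then show ?thesis by linarith
    qed
    then show "\<exists>U. 0 \<in> interior U \<and> (\<forall>x y. x - y \<in> U \<longrightarrow> \<bar>f x + h x - (f y + h y)\<bar> \<le> \<epsilon>)"
      using U(1) V(1) by (intro exI[of _ "U \<inter> V"]) auto
  qed
  moreover have "bounded (range (\<lambda>x. f x + h x))"
    using assms by (auto simp: UCb_right_def intro: bounded_plus_comp)
  ultimately show ?thesis by (simp add: UCb_right_def)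
qed

lemma UCb_right_cmult:
  assumes "f \<in> UCb_right"
  shows "(\<lambda>x. c * f x) \<in> UCb_right"
proof -
  have "right_uniformly_continuous (\<lambda>x. c * f x)"
    unfolding right_uniformly_continuous_def
  proof (intro allI impI)
    fix \<epsilon> :: real assume "\<epsilon> > 0"
    then have "\<epsilon> / (\<bar>c\<bar> + 1) > 0" by (simp add: add_nonneg_pos)
    then obtain U where U: "0 \<in> interior U" "\<And>x y. x - y \<in> U \<Longrightarrow> \<bar>f x - f y\<bar> \<le> \<epsilon> / (\<bar>c\<bar> + 1)"
      using assms unfolding UCb_right_def right_uniformly_continuous_def by blast
    have "\<bar>c * f x - c * f y\<bar> \<le> \<epsilon>" if "x - y \<in> U" for x y
    proof -
      have "\<bar>c * f x - c * f y\<bar> = \<bar>c\<bar> * \<bar>f x - f y\<bar>"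
        by (simp add: abs_mult right_diff_distrib flip: abs_mult)
      also have "\<dots> \<le> (\<bar>c\<bar> + 1) * (\<epsilon> / (\<bar>c\<bar> + 1))"
        by (intro mult_mono U(2) that) auto
      also have "\<dots> = \<epsilon>" by (simp add: add_nonneg_eq_0_iff)
      finally show ?thesis .
    qed
    then show "\<exists>U. 0 \<in> interior U \<and> (\<forall>x y. x - y \<in> U \<longrightarrow> \<bar>c * f x - c * f y\<bar> \<le> \<epsilon>)"
      using U(1) by auto
  qed
  moreover have "bounded (range (\<lambda>x. c * f x))"
    using assms bounded_scaling[of "range f" c] by (simp add: UCb_right_def image_image)
  ultimately show ?thesis by (simp add: UCb_right_def)
qed

lemma UCb_right_sum:
  assumes "\<And>i. i \<in> I \<Longrightarrow> f i \<in> UCb_right"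
  shows "(\<lambda>x. \<Sum>i\<in>I. f i x) \<in> UCb_right"
  using assms by (induction I rule: infinite_finite_induct) (auto intro: UCb_right_const UCb_right_add)

lemma UCb_right_translate:
  fixes f :: "'a::topological_group_add \<Rightarrow> real"
  assumes "f \<in> UCb_right"
  shows "f \<circ> (\<lambda>x. g + x) \<in> UCb_right"
proof -
  have "right_uniformly_continuous (f \<circ> (\<lambda>x. g + x))"
    unfolding right_uniformly_continuous_def
  proof (intro allI impI)
    fix \<epsilon> :: real assume "\<epsilon> > 0"
    then obtain U where U: "0 \<in> interior U" "\<And>x y. x - y \<in> U \<Longrightarrow> \<bar>f x - f y\<bar> \<le> \<epsilon>"
      using assms unfolding UCb_right_def right_uniformly_continuous_def by blast
    \<comment> \<open>left translation conjugates the right differences \<open>x - y\<close> by \<open>g\<close>\<close>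
    let ?V = "(\<lambda>u. g + u + - g) -` interior U"
    have "open ?V" by (intro open_vimage continuous_intros) simp
    moreover have "0 \<in> ?V" using U(1) by simp
    moreover have "\<bar>(f \<circ> (\<lambda>x. g + x)) x - (f \<circ> (\<lambda>x. g + x)) y\<bar> \<le> \<epsilon>" if "x - y \<in> ?V" for x y
    proof -
      have "(g + x) - (g + y) = g + (x - y) + - g"
        by (simp only: diff_conv_add_uminus minus_add add.assoc)
      then have "(g + x) - (g + y) \<in> U"
        using that interior_subset by auto
      then show ?thesis using U(2) by simp
    qed
    ultimately show "\<exists>U. 0 \<in> interior U \<and>
        (\<forall>x y. x - y \<in> U \<longrightarrow> \<bar>(f \<circ> (\<lambda>x. g + x)) x - (f \<circ> (\<lambda>x. g + x)) y\<bar> \<le> \<epsilon>)"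
      by (metis interior_open)
  qed
  moreover have "bounded (range (f \<circ> (\<lambda>x. g + x)))"
    using assms by (auto simp: UCb_right_def intro: bounded_subset)
  ultimately show ?thesis by (simp add: UCb_right_def)
qed

lemma mean_right_add:
  assumes "mean_right \<nu>" "f \<in> UCb_right" "h \<in> UCb_right"
  shows "\<nu> (\<lambda>x. f x + h x) = \<nu> f + \<nu> h"
  using assms unfolding mean_right_def by metis

lemma mean_right_cmult:
  assumes "mean_right \<nu>" "f \<in> UCb_right"
  shows "\<nu> (\<lambda>x. c * f x) = c * \<nu> f"
  using assms unfolding mean_right_def by metis

lemma mean_right_sum:
  assumes "mean_right \<nu>" "\<And>i. i \<in> I \<Longrightarrow> f i \<in> UCb_right"
  shows "\<nu> (\<lambda>x. \<Sum>i\<in>I. f i x) = (\<Sum>i\<in>I. \<nu> (f i))"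
proof -
  have zero: "\<nu> (\<lambda>_. 0) = 0"
    using mean_right_cmult[OF assms(1) UCb_right_const[of 0], of 0] by simp
  show ?thesis
    using assms(2)
  proof (induction I rule: infinite_finite_induct)
    case (insert i I)
    have "f i \<in> UCb_right" "(\<lambda>x. \<Sum>i\<in>I. f i x) \<in> UCb_right"
      using insert.prems UCb_right_sum[of I f] by auto
    then have "\<nu> (\<lambda>x. f i x + (\<Sum>i\<in>I. f i x)) = \<nu> (f i) + \<nu> (\<lambda>x. \<Sum>i\<in>I. f i x)"
      by (rule mean_right_add[OF assms(1)])
    then show ?case using insert by simp
  qed (simp_all add: zero)
qed


section \<open>Uniformly continuous functions that separate\<close>

lemma nbhd_triple_sum:
  fixes U :: "'a::topological_group_add set"
  assumes "open U" "0 \<in> U"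
  obtains V where "open V" "0 \<in> V" "\<And>a b c. a \<in> V \<Longrightarrow> b \<in> V \<Longrightarrow> c \<in> V \<Longrightarrow> a + b + c \<in> U"
proof -
  have double: "\<exists>V. open V \<and> 0 \<in> V \<and> (\<forall>a\<in>V. \<forall>b\<in>V. a + b \<in> U)"
    if "open U" "0 \<in> U" for U :: "'a set"
  proof -
    have "open ((\<lambda>p::'a\<times>'a. fst p + snd p) -` U)"
      by (intro open_vimage that continuous_intros)
    moreover have "(0, 0) \<in> (\<lambda>p::'a\<times>'a. fst p + snd p) -` U"
      using that by simp
    ultimately obtain A B where "open A" "open B" "(0,0) \<in> A \<times> B"
      "A \<times> B \<subseteq> (\<lambda>p::'a\<times>'a. fst p + snd p) -` U"
      by (rule open_prod_elim)
    then show ?thesis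
      by (intro exI[of _ "A \<inter> B"]) auto
  qed
  obtain V where V: "open V" "0 \<in> V" "\<forall>a\<in>V. \<forall>b\<in>V. a + b \<in> U"
    using double[OF assms] by blast
  obtain V' where V': "open V'" "0 \<in> V'" "\<forall>a\<in>V'. \<forall>b\<in>V'. a + b \<in> V"
    using double[OF V(1,2)] by blast
  show thesis
    by (rule that[of "V \<inter> V'"]) (use V V' in auto)
qed

text \<open>
  The element \<open>p\<close> is the one at which the partial sums of the weights pass \<open>t\<close>.
\<close>

lemma split_at_weight:
  fixes w :: "'b \<Rightarrow> real"
  assumes "ps \<noteq> []" "0 \<le> t" "t \<le> sum_list (map w ps)"
  shows "\<exists>as p bs. ps = as @ p # bs \<and> sum_list (map w as) \<le> t
           \<and> sum_list (map w bs) \<le> sum_list (map w ps) - t"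
  using assms
proof (induction ps arbitrary: t)
  case (Cons p qs)
  show ?case
  proof (cases "t \<le> w p")
    case True
    then show ?thesis
      using Cons.prems by (intro exI[of _ "[]"] exI[of _ p] exI[of _ qs]) auto
  next
    case False
    then have "qs \<noteq> []" "0 \<le> t - w p" "t - w p \<le> sum_list (map w qs)"
      using Cons.prems by auto
    from Cons.IH[OF this] obtain as r bs where "qs = as @ r # bs"
      "sum_list (map w as) \<le> t - w p" "sum_list (map w bs) \<le> sum_list (map w qs) - (t - w p)"
      by blast
    then show ?thesis
      by (intro exI[of _ "p # as"] exI[of _ r] exI[of _ bs]) auto
  qed
qed simp

text \<open>
  A list of pairs \<open>(n, v)\<close> records a sum of group elements \<open>v\<close> in this order, with \<open>v\<close> taken from
  the \<open>n\<close>-th neighbourhood of a decreasing sequence; the price of such a summand is \<open>2\<^sup>-\<^sup>n\<close>.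
\<close>

definition dyadic_weight :: "(nat \<times> 'a) list \<Rightarrow> real" where
  "dyadic_weight ps = (\<Sum>p\<leftarrow>ps. (1/2) ^ fst p)"

lemma dyadic_weight_nonneg: "0 \<le> dyadic_weight ps"
  unfolding dyadic_weight_def by (rule sum_list_nonneg) auto

text \<open>
  The combinatorial heart of the Birkhoff--Kakutani metrization theorem. Cut the list at half of
  its weight: both outer parts weigh less than \<open>2\<^sup>-\<^sup>(\<^sup>n\<^sup>+\<^sup>1\<^sup>)\<close> and, by induction, have their sums in
  \<open>V (Suc n)\<close>. The single element in between lies there too, since its own weight is less than
  \<open>2\<^sup>-\<^sup>n\<close>. Three summands occur because the order of summation must be kept.
\<close>

lemma sum_in_nbhd_if_dyadic_weight_less:
  fixes V :: "nat \<Rightarrow> 'a::monoid_add set"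
  assumes zero: "\<And>n. 0 \<in> V n"
    and triple: "\<And>n a b c. a \<in> V (Suc n) \<Longrightarrow> b \<in> V (Suc n) \<Longrightarrow> c \<in> V (Suc n) \<Longrightarrow> a + b + c \<in> V n"
    and "\<forall>p\<in>set ps. snd p \<in> V (fst p)" "dyadic_weight ps < (1/2) ^ n"
  shows "sum_list (map snd ps) \<in> V n"
  using assms(3,4)
proof (induction "length ps" arbitrary: ps n rule: less_induct)
  case less
  have "V (Suc n) \<subseteq> V n" for n
    using triple[of _ n 0 0] zero by auto
  then have anti: "V m \<subseteq> V n" if "n \<le> m" for m n
    using that by (rule lift_Suc_antimono_le)
  show ?case
  proof (cases "ps = []")
    case True
    then show ?thesis using zero by simp
  next
    case False
    let ?s = "dyadic_weight ps"
    obtain as p bs where ps: "ps = as @ p # bs"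
      and as: "dyadic_weight as \<le> ?s / 2" and bs: "dyadic_weight bs \<le> ?s - ?s / 2"
      using split_at_weight[OF False, of "?s / 2" "\<lambda>p. (1/2) ^ fst p", folded dyadic_weight_def]
        dyadic_weight_nonneg[of ps] by force
    have "sum_list (map snd as) \<in> V (Suc n)" "sum_list (map snd bs) \<in> V (Suc n)"
      using less.prems as bs by (intro less.hyps; simp add: ps)+
    moreover have "snd p \<in> V (Suc n)"
    proof -
      have "?s = dyadic_weight as + (1/2) ^ fst p + dyadic_weight bs"
        by (simp add: ps dyadic_weight_def)
      then have "(1/2::real) ^ fst p < (1/2) ^ n"
        using less.prems(2) dyadic_weight_nonneg[of as] dyadic_weight_nonneg[of bs] by linarith
      then have "Suc n \<le> fst p"
        by (simp add: Suc_le_eq power_strict_decreasing_iff)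
      then show ?thesis
        using anti less.prems(1) ps by auto
    qed
    ultimately have "sum_list (map snd as) + snd p + sum_list (map snd bs) \<in> V n"
      by (intro triple)
    then show ?thesis
      by (simp add: ps add.assoc)
  qed
qed

text \<open>
  The length of \<open>x\<close> is the cheapest dyadic weight of a list with sum \<open>x\<close>, so subadditivity is
  concatenation of lists. The sequence of neighbourhoods starts with the whole group in order that
  every \<open>x\<close> is the sum of some list; the next neighbourhood is inside \<open>W\<close>, whence the bound \<open>1/2\<close>.
\<close>

lemma small_length_function:
  fixes W :: "'a::topological_group_add set"
  assumes "0 \<in> interior W"
  obtains d :: "'a \<Rightarrow> real" where "\<And>x. 0 \<le> d x" "d 0 = 0" "\<And>x y. d (x + y) \<le> d x + d y"
    "\<And>\<epsilon>. \<epsilon> > 0 \<Longrightarrow> \<exists>U. open U \<and> 0 \<in> U \<and> (\<forall>u\<in>U. d u \<le> \<epsilon>)"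
    "\<And>x. d x < 1/2 \<Longrightarrow> x \<in> W"
proof -
  have "\<exists>V. \<forall>n::nat. (open (V n) \<and> 0 \<in> V n \<and> (n = 0 \<longrightarrow> V n = UNIV) \<and> (n > 0 \<longrightarrow> V n \<subseteq> W)) \<and>
      (\<forall>a b c. a \<in> V (Suc n) \<longrightarrow> b \<in> V (Suc n) \<longrightarrow> c \<in> V (Suc n) \<longrightarrow> a + b + c \<in> V n)"
  proof (rule dependent_nat_choice)
    fix X :: "'a set" and n :: nat
    assume "open X \<and> 0 \<in> X \<and> (n = 0 \<longrightarrow> X = UNIV) \<and> (0 < n \<longrightarrow> X \<subseteq> W)"
    then obtain Y where "open Y" "0 \<in> Y" "\<And>a b c. a \<in> Y \<Longrightarrow> b \<in> Y \<Longrightarrow> c \<in> Y \<Longrightarrow> a + b + c \<in> X"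
      using nbhd_triple_sum by metis
    then show "\<exists>Y. (open Y \<and> 0 \<in> Y \<and> (Suc n = 0 \<longrightarrow> Y = UNIV) \<and> (0 < Suc n \<longrightarrow> Y \<subseteq> W)) \<and>
        (\<forall>a b c. a \<in> Y \<longrightarrow> b \<in> Y \<longrightarrow> c \<in> Y \<longrightarrow> a + b + c \<in> X)"
      using assms interior_subset[of W] by (intro exI[of _ "Y \<inter> interior W"]) auto
  qed auto
  then obtain V :: "nat \<Rightarrow> 'a set" where V: "\<And>n. open (V n)" "\<And>n. 0 \<in> V n" "V 0 = UNIV"
    "\<And>n. V (Suc n) \<subseteq> W"
    "\<And>n a b c. a \<in> V (Suc n) \<Longrightarrow> b \<in> V (Suc n) \<Longrightarrow> c \<in> V (Suc n) \<Longrightarrow> a + b + c \<in> V n"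
    by (metis zero_less_Suc)
  define chains where
    "chains x = {ps. (\<forall>p\<in>set ps. snd p \<in> V (fst p)) \<and> sum_list (map snd ps) = x}" for x
  define d where "d x = (INF ps\<in>chains x. dyadic_weight ps)" for x
  have bdd: "bdd_below (dyadic_weight ` chains x)" for x
    by (rule bdd_belowI[of _ 0]) (auto simp: dyadic_weight_nonneg)
  have ne: "chains x \<noteq> {}" for x
  proof -
    have "[(0, x)] \<in> chains x" by (simp add: chains_def V(3))
    then show ?thesis by blast
  qed
  have le: "d x \<le> dyadic_weight ps" if "ps \<in> chains x" for x ps
    unfolding d_def by (rule cINF_lower[OF bdd that])
  have less: "\<exists>ps\<in>chains x. dyadic_weight ps < t" if "d x < t" for x t
    using that unfolding d_def by (simp add: cINF_less_iff[OF ne bdd])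
  show thesis
  proof (rule that[of d])
    show nonneg: "0 \<le> d x" for x
      unfolding d_def by (rule cINF_greatest[OF ne dyadic_weight_nonneg])
    have "d 0 \<le> dyadic_weight ([] :: (nat \<times> 'a) list)" by (rule le) (simp add: chains_def)
    then show "d 0 = 0" using nonneg[of 0] by (simp add: dyadic_weight_def)
    show "d (x + y) \<le> d x + d y" for x y
    proof (rule field_le_epsilon)
      fix e :: real assume "e > 0"
      then obtain ps qs where "ps \<in> chains x" "dyadic_weight ps < d x + e/2"
        "qs \<in> chains y" "dyadic_weight qs < d y + e/2"
        using less[of x "d x + e/2"] less[of y "d y + e/2"] by auto
      moreover from this have "d (x + y) \<le> dyadic_weight (ps @ qs)"
        by (intro le) (auto simp: chains_def)
      ultimately show "d (x + y) \<le> d x + d y + e"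
        by (simp add: dyadic_weight_def)
    qed
    show "\<exists>U. open U \<and> 0 \<in> U \<and> (\<forall>u\<in>U. d u \<le> \<epsilon>)" if "\<epsilon> > 0" for \<epsilon>
    proof -
      obtain n where n: "(1/2::real) ^ n < \<epsilon>"
        using real_arch_pow_inv[of \<epsilon> "1/2"] \<open>\<epsilon> > 0\<close> by auto
      have "d u \<le> \<epsilon>" if "u \<in> V n" for u
        using le[of "[(n, u)]" u] n that by (auto simp: chains_def dyadic_weight_def)
      then show ?thesis using V(1,2) by blast
    qed
    show "x \<in> W" if "d x < 1/2" for x
    proof -
      obtain ps where "ps \<in> chains x" "dyadic_weight ps < (1/2) ^ 1"
        using less[OF \<open>d x < 1/2\<close>] by auto
      then have "x \<in> V 1"
        using sum_in_nbhd_if_dyadic_weight_less[of V ps 1] V(2,5) by (auto simp: chains_def)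
      then show ?thesis using V(4)[of 0] by auto
    qed
  qed
qed

text \<open>
  Up to scaling and truncation, \<open>q x\<close> is the distance from \<open>x\<close> to the complement of \<open>A\<close>, measured
  by the length of \<open>z - x\<close>. The length need not be symmetric, so its subadditivity bounds the
  difference of \<open>q x\<close> and \<open>q y\<close> by the larger of the lengths of \<open>x - y\<close> and \<open>y - x\<close>; both are small
  for \<open>x - y\<close> in a symmetric neighbourhood.
\<close>

lemma uniform_Urysohn:
  fixes W A :: "'a::topological_group_add set"
  assumes "0 \<in> interior W"
  obtains q where "q \<in> UCb_right" "\<And>x. 0 \<le> q x" "\<And>x. q x \<le> 1"
    "\<And>x. x \<notin> A \<Longrightarrow> q x = 0" "\<And>x. (\<lambda>u. u + x) ` W \<subseteq> A \<Longrightarrow> q x = 1"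
proof (cases "A = UNIV")
  \<comment> \<open>no point lies outside \<open>A\<close>, so there is no distance to its complement\<close>
  case True
  show thesis
    by (rule that[OF UCb_right_const[of 1]]) (use True in auto)
next
  case False
  show thesis
  proof (rule small_length_function[OF assms])
    fix d :: "'a \<Rightarrow> real"
    assume d: "\<And>x. 0 \<le> d x" "d 0 = 0" "\<And>x y. d (x + y) \<le> d x + d y"
      "\<And>\<epsilon>. \<epsilon> > 0 \<Longrightarrow> \<exists>U. open U \<and> 0 \<in> U \<and> (\<forall>u\<in>U. d u \<le> \<epsilon>)"
      "\<And>x. d x < 1/2 \<Longrightarrow> x \<in> W"
    define r where "r x = (INF z\<in>-A. d (z - x))" for x
    define q where "q x = min 1 (2 * r x)" for x
    have bdd: "bdd_below ((\<lambda>z. d (z - x)) ` (- A))" for x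
      by (rule bdd_belowI[of _ 0]) (auto simp: d)
    have ne: "- A \<noteq> {}" using False by auto
    have le: "r x \<le> d (z - x)" if "z \<notin> A" for x z
      unfolding r_def using that by (intro cINF_lower[OF bdd]) auto
    have nonneg: "0 \<le> r x" for x
      unfolding r_def by (rule cINF_greatest[OF ne d(1)])
    have r_diff: "r x \<le> r y + d (y - x)" for x y
    proof -
      have "r x - d (y - x) \<le> d (z - y)" if "z \<in> - A" for z
        using le[of z x] d(3)[of "z - y" "y - x"] that by (simp add: add_diff_eq)
      then have "r x - d (y - x) \<le> r y"
        unfolding r_def[of y] by (intro cINF_greatest[OF ne])
      then show ?thesis by simp
    qed
    show thesis
    proof (rule that[of q])
      have "right_uniformly_continuous q"
        unfolding right_uniformly_continuous_def
      proof (intro allI impI)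
        fix \<epsilon> :: real assume "\<epsilon> > 0"
        then obtain U where U: "open U" "0 \<in> U" "\<forall>u\<in>U. d u \<le> \<epsilon> / 2"
          using d(4)[of "\<epsilon> / 2"] by auto
        have "open (uminus -` U)"
          by (intro open_vimage U continuous_intros)
        then have "open (U \<inter> uminus -` U)" "0 \<in> U \<inter> uminus -` U"
          using U by auto
        moreover have "\<bar>q x - q y\<bar> \<le> \<epsilon>" if "x - y \<in> U \<inter> uminus -` U" for x y
        proof -
          have "d (x - y) \<le> \<epsilon> / 2" "d (y - x) \<le> \<epsilon> / 2"
            using that U(3) by auto
          then show ?thesis
            using r_diff[of x y] r_diff[of y x] unfolding q_def by auto
        qed
        ultimately show "\<exists>U. 0 \<in> interior U \<and> (\<forall>x y. x - y \<in> U \<longrightarrow> \<bar>q x - q y\<bar> \<le> \<epsilon>)"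
          by (metis interior_open)
      qed
      moreover have "bounded (range q)"
        using nonneg by (intro boundedI[of _ 1]) (auto simp: q_def)
      ultimately show "q \<in> UCb_right"
        by (simp add: UCb_right_def)
      show "0 \<le> q x" "q x \<le> 1" for x
        using nonneg by (auto simp: q_def)
      show "q x = 0" if "x \<notin> A" for x
        using le[OF that, of x] nonneg[of x] d(2) by (simp add: q_def)
      show "q x = 1" if "(\<lambda>u. u + x) ` W \<subseteq> A" for x
      proof -
        have "1/2 \<le> d (z - x)" if "z \<in> - A" for z
        proof (rule ccontr)
          assume "\<not> ?thesis"
          then have "z - x + x \<in> A"
            using d(5) \<open>_ \<subseteq> A\<close> by (metis image_subset_iff not_le)
          then show False using that by simp
        qed
        then have "1/2 \<le> r x"
          unfolding r_def by (intro cINF_greatest[OF ne])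
        then show ?thesis by (simp add: q_def)
      qed
    qed
  qed
qed

section \<open>Sets that balance finitely many functions of mean zero\<close>

text \<open>
  Both \<open>g - h\<close> and \<open>h - g\<close> must avoid \<open>D\<close>, so a new point \<open>g\<close> is chosen outside finitely many
  translates of \<open>D\<close> and of \<open>-D\<close>.
\<close>

lemma scattered_set_exists:
  fixes D :: "'a::group_add set"
  assumes "infinite (UNIV :: 'a set)" "finite D"
  shows "\<exists>T. finite T \<and> card T = n \<and> (\<forall>g\<in>T. \<forall>h\<in>T. g \<noteq> h \<longrightarrow> g - h \<notin> D)"
proof (induction n)
  case 0
  show ?case by (intro exI[of _ "{}"]) simp
next
  case (Suc n)
  then obtain T where T: "finite T" "card T = n" "\<forall>g\<in>T. \<forall>h\<in>T. g \<noteq> h \<longrightarrow> g - h \<notin> D" by blast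
  have "finite (T \<union> (\<Union>h\<in>T. (\<lambda>d. d + h) ` D \<union> (\<lambda>d. - d + h) ` D))"
    using T assms(2) by blast
  from ex_new_if_finite[OF assms(1) this] obtain g
    where g: "g \<notin> T" "\<And>h d. h \<in> T \<Longrightarrow> d \<in> D \<Longrightarrow> g \<noteq> d + h \<and> g \<noteq> - d + h"
    by auto
  have "g - h \<notin> D \<and> h - g \<notin> D" if "h \<in> T" for h
    using g(2)[OF that, of "g - h"] g(2)[OF that, of "h - g"] by auto
  then show ?case
    using T g(1) by (intro exI[of _ "insert g T"]) auto
qed

text \<open>
  If \<open>f\<close> were at least \<open>1\<close> outside a finite set, then finitely many translates could be chosen such
  that every point is exceptional for at most one of them. The sum of enough such translates is at
  least \<open>1\<close> everywhere, while by invariance its mean is \<open>0\<close>.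
\<close>

lemma infinite_below_one_if_mean_zero:
  fixes f :: "'a::topological_group_add \<Rightarrow> real"
  assumes inf: "infinite (UNIV :: 'a set)"
    and mean: "mean_right \<nu>" and inv: "\<And>f g. f \<in> UCb_right \<Longrightarrow> \<nu> (f \<circ> (\<lambda>x. g + x)) = \<nu> f"
    and f: "f \<in> UCb_right" "\<nu> f = 0"
  shows "infinite {x. f x < 1}"
proof
  assume fin: "finite {x. f x < 1}"
  \<comment> \<open>the translates by \<open>g\<close> and \<open>h\<close> share an exceptional point only if \<open>g - h \<in> D\<close>\<close>
  define D where "D = (\<lambda>(a, b). a - b) ` ({x. f x < 1} \<times> {x. f x < 1})"
  have "finite D" using fin by (simp add: D_def)
  obtain B where B: "B > 0" "\<And>x. \<bar>f x\<bar> \<le> B" using UCb_right_bound[OF f(1)] by blast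
  \<comment> \<open>\<open>n - 1\<close> summands are at least \<open>1\<close> and the remaining one is at least \<open>- B\<close>\<close>
  obtain n where n: "real n \<ge> B + 2" using real_arch_simple[of "B + 2"] by auto
  obtain T where T: "finite T" "card T = n" "\<forall>g\<in>T. \<forall>h\<in>T. g \<noteq> h \<longrightarrow> g - h \<notin> D"
    using scattered_set_exists[OF inf \<open>finite D\<close>, of n] by auto
  define s where "s x = (\<Sum>g\<in>T. (f \<circ> (\<lambda>x. g + x)) x)" for x
  have s_ge: "1 \<le> s x" for x
  proof (cases "\<exists>g\<in>T. f (g + x) < 1")
    case True
    then obtain g where g: "g \<in> T" "f (g + x) < 1" by blast
    have "1 \<le> f (h + x)" if "h \<in> T - {g}" for h
    proof (rule ccontr)
      assume "\<not> ?thesis"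
      then have "(g + x) - (h + x) \<in> D"
        using g by (force simp: D_def)
      moreover have "(g + x) - (h + x) = g - h"
        by (simp add: diff_conv_add_uminus minus_add add.assoc del: add_uminus_conv_diff)
      ultimately show False
        using T(3) g that by auto
    qed
    then have "(\<Sum>h\<in>T - {g}. 1) \<le> (\<Sum>h\<in>T - {g}. f (h + x))"
      by (intro sum_mono)
    moreover have "s x = f (g + x) + (\<Sum>h\<in>T - {g}. f (h + x))"
      unfolding s_def o_def by (rule sum.remove[OF T(1) g(1)])
    moreover have "real (card (T - {g})) = real n - 1"
      using card_Suc_Diff1[OF T(1) g(1)] T(2) by simp
    ultimately show ?thesis
      using B(2)[of "g + x"] n by simp
  next
    case False
    then have "(\<Sum>g\<in>T. 1) \<le> s x"
      unfolding s_def by (intro sum_mono) (auto simp: not_less)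
    then show ?thesis using T n B(1) by simp
  qed
  have tr: "f \<circ> (\<lambda>x. g + x) \<in> UCb_right" for g
    by (rule UCb_right_translate[OF f(1)])
  have "s \<in> UCb_right"
    unfolding s_def by (rule UCb_right_sum[OF tr])
  then have "(INF x. s x) \<le> \<nu> s"
    using mean by (simp add: mean_right_def)
  moreover have "\<nu> s = 0"
    unfolding s_def using mean_right_sum[where I = T and f = "\<lambda>g. f \<circ> (\<lambda>x. g + x)", OF mean tr] inv[OF f(1)] f(2)
    by simp
  moreover have "1 \<le> (INF x. s x)"
    by (rule cINF_greatest) (use s_ge in auto)
  ultimately show False by linarith
qed

text \<open>
  A new point \<open>x\<close> changes the sum of squares by twice the inner product of the old sums \<open>c k\<close> with
  the values \<open>k x\<close>, plus \<open>\<Sum>k\<in>K. (k x)\<^sup>2\<close>. Choosing \<open>x\<close> where the inner product is less than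
  \<open>1\<close> keeps the increase below \<open>2 + card K\<close>; there are infinitely many such points, so \<open>x\<close> can be
  taken outside \<open>F\<close>.
\<close>

lemma balanced_set_exists:
  fixes K :: "('a \<Rightarrow> real) set"
  assumes "finite K" "\<And>k x. k \<in> K \<Longrightarrow> \<bar>k x\<bar> \<le> 1"
    and inf: "\<And>c. infinite {x. (\<Sum>k\<in>K. c k * k x) < 1}"
  shows "\<exists>F. finite F \<and> card F = n \<and> (\<Sum>k\<in>K. (\<Sum>x\<in>F. k x)\<^sup>2) \<le> (2 + real (card K)) * real n"
proof (induction n)
  case 0
  show ?case by (intro exI[of _ "{}"]) simp
next
  case (Suc n)
  then obtain F where F: "finite F" "card F = n"
    "(\<Sum>k\<in>K. (\<Sum>x\<in>F. k x)\<^sup>2) \<le> (2 + real (card K)) * real n" by blast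
  define c where "c k = (\<Sum>x\<in>F. k x)" for k :: "'a \<Rightarrow> real"
  obtain x where x: "(\<Sum>k\<in>K. c k * k x) < 1" "x \<notin> F"
    using finite_subset[OF _ F(1), of "{x. (\<Sum>k\<in>K. c k * k x) < 1}"] inf[of c] by blast
  have "(\<Sum>k\<in>K. (\<Sum>x\<in>insert x F. k x)\<^sup>2) = (\<Sum>k\<in>K. (c k)\<^sup>2 + 2 * (c k * k x) + (k x)\<^sup>2)"
    using F(1) x(2) by (intro sum.cong refl) (simp add: c_def power2_sum algebra_simps)
  also have "\<dots> = (\<Sum>k\<in>K. (c k)\<^sup>2) + 2 * (\<Sum>k\<in>K. c k * k x) + (\<Sum>k\<in>K. (k x)\<^sup>2)"
    by (simp add: sum.distrib sum_distrib_left)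
  also have "(\<Sum>k\<in>K. (k x)\<^sup>2) \<le> (\<Sum>k\<in>K. 1)"
    using assms(2) by (intro sum_mono) (simp add: abs_square_le_1)
  finally have "(\<Sum>k\<in>K. (\<Sum>x\<in>insert x F. k x)\<^sup>2) \<le> (2 + real (card K)) * real (Suc n)"
    using F(3) x(1) by (simp add: c_def algebra_simps)
  then show ?case
    using F x(2) by (intro exI[of _ "insert x F"]) auto
qed

section \<open>Matchings with defect\<close>

text \<open>
  Hall's marriage theorem with defect, by Rado's argument. Remove candidates from the sets \<open>N x\<close> as
  long as the condition survives. If some \<open>N x\<close> contains \<open>y \<noteq> z\<close> and neither can be removed, there
  are sets \<open>S\<close> and \<open>T\<close> violating the condition after the respective removals. Both contain \<open>x\<close>;
  submodularity of the cardinality then contradicts the original condition for \<open>S \<union> T\<close> and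
  \<open>S \<inter> T - {x}\<close>. Once every \<open>N x\<close> has at most one element, it suffices to choose for each
  available partner one element of \<open>F\<close> that wants it.
\<close>

lemma matching_with_defect:
  fixes N :: "'a \<Rightarrow> 'b set"
  assumes "finite F" "\<And>x. x \<in> F \<Longrightarrow> finite (N x)"
    and "\<And>S. S \<subseteq> F \<Longrightarrow> card S \<le> card (\<Union>(N ` S)) + k"
  obtains D \<phi> where "D \<subseteq> F" "inj_on \<phi> D" "\<And>x. x \<in> D \<Longrightarrow> \<phi> x \<in> N x" "card F \<le> card D + k"
proof -
  have "\<exists>D \<phi>. D \<subseteq> F \<and> inj_on \<phi> D \<and> (\<forall>x\<in>D. \<phi> x \<in> N x) \<and> card F \<le> card D + k"
    using assms(2,3)
  proof (induction "\<Sum>x\<in>F. card (N x)" arbitrary: N rule: less_induct)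
    case less
    note fin = less.prems(1) and hall = less.prems(2)
    have fin_Un: "finite (\<Union>(N ` S))" if "S \<subseteq> F" for S
      using fin that \<open>finite F\<close> by (meson finite_UN finite_subset subsetD)
    show ?case
    proof (cases "\<exists>x\<in>F. \<exists>y\<in>N x. \<exists>z\<in>N x. y \<noteq> z")
      case True
      then obtain x y z where xyz: "x \<in> F" "y \<in> N x" "z \<in> N x" "y \<noteq> z" by blast
      define M where "M u = N(x := N x - {u})" for u
      \<comment> \<open>removing one of the two candidates preserves the condition\<close>
      have "\<exists>u\<in>{y, z}. \<forall>S\<subseteq>F. card S \<le> card (\<Union>(M u ` S)) + k"
      proof (rule ccontr)
        assume "\<not> ?thesis"
        then obtain S T where S: "S \<subseteq> F" "card (\<Union>(M y ` S)) + k < card S"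
          and T: "T \<subseteq> F" "card (\<Union>(M z ` T)) + k < card T"
          by (auto simp: not_le)
        have xS: "x \<in> S"
        proof (rule ccontr)
          assume "x \<notin> S"
          then have "M y ` S = N ` S" by (auto simp: M_def)
          then show False using S hall[of S] by simp
        qed
        have xT: "x \<in> T"
        proof (rule ccontr)
          assume "x \<notin> T"
          then have "M z ` T = N ` T" by (auto simp: M_def)
          then show False using T hall[of T] by simp
        qed
        let ?A = "\<Union>(M y ` S)" and ?B = "\<Union>(M z ` T)"
        have finA: "finite ?A" and finB: "finite ?B"
          by (rule finite_subset[OF _ fin_Un[OF S(1)]], force simp: M_def split: if_splits)
             (rule finite_subset[OF _ fin_Un[OF T(1)]], force simp: M_def split: if_splits)
        have finS: "finite S" and finT: "finite T"
          using S T \<open>finite F\<close> finite_subset by auto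
        have "\<Union>(N ` (S \<union> T)) \<subseteq> ?A \<union> ?B"
        proof
          fix v assume "v \<in> \<Union>(N ` (S \<union> T))"
          then obtain w where w: "w \<in> S \<union> T" "v \<in> N w" by auto
          show "v \<in> ?A \<union> ?B"
          proof (cases "w = x")
            case True
            then show ?thesis
              using w xS xT xyz(4) by (cases "v = y") (auto simp: M_def)
          next
            case False
            then show ?thesis using w by (auto simp: M_def)
          qed
        qed
        then have "card (S \<union> T) \<le> card (?A \<union> ?B) + k"
          using hall[of "S \<union> T"] S T card_mono[of "?A \<union> ?B"] finA finB
          by (meson Un_least add_le_mono1 finite_UnI le_trans)
        moreover have "\<Union>(N ` (S \<inter> T - {x})) \<subseteq> ?A \<inter> ?B"
          by (auto simp: M_def)
        then have "card (S \<inter> T - {x}) \<le> card (?A \<inter> ?B) + k"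
          using hall[of "S \<inter> T - {x}"] S card_mono[of "?A \<inter> ?B" "\<Union>(N ` (S \<inter> T - {x}))"] finA
          by (meson Diff_subset Int_lower1 add_le_mono1 finite_Int le_trans subset_trans)
        moreover have "card (S \<inter> T) = Suc (card (S \<inter> T - {x}))"
          using xS xT finS card_Suc_Diff1[of "S \<inter> T" x] by simp
        ultimately show False
          using S(2) T(2) card_Un_Int[OF finA finB] card_Un_Int[OF finS finT] by linarith
      qed
      then obtain u where u: "u \<in> N x" "\<And>S. S \<subseteq> F \<Longrightarrow> card S \<le> card (\<Union>(M u ` S)) + k"
        using xyz by blast
      have "(\<Sum>v\<in>F. card (M u v)) < (\<Sum>v\<in>F. card (N v))"
      proof (rule sum_strict_mono_ex1)
        show "\<forall>v\<in>F. card (M u v) \<le> card (N v)"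
          using fin by (auto simp: M_def intro: card_mono)
        show "\<exists>v\<in>F. card (M u v) < card (N v)"
          using u(1) fin xyz(1) by (intro bexI[of _ x]) (simp_all add: M_def card_Diff1_less del: card_Diff_insert)
      qed fact
      moreover have "finite (M u v)" if "v \<in> F" for v
        using fin[OF that] by (auto simp: M_def)
      ultimately have "\<exists>D \<phi>. D \<subseteq> F \<and> inj_on \<phi> D \<and> (\<forall>v\<in>D. \<phi> v \<in> M u v) \<and> card F \<le> card D + k"
        using u(2) by (rule less.hyps)
      moreover have "M u v \<subseteq> N v" for v
        by (auto simp: M_def)
      ultimately show ?thesis by blast
    next
      case False
      define \<psi> where "\<psi> y = (SOME x. x \<in> F \<and> y \<in> N x)" for y
      have \<psi>: "\<psi> y \<in> F \<and> y \<in> N (\<psi> y)" if "y \<in> \<Union>(N ` F)" for y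
        unfolding \<psi>_def by (rule someI_ex) (use that in auto)
      have inj: "inj_on \<psi> (\<Union>(N ` F))"
        by (rule inj_onI) (metis False \<psi>)
      show ?thesis
      proof (intro exI conjI)
        show "\<psi> ` \<Union>(N ` F) \<subseteq> F" using \<psi> by blast
        show "inj_on (the_inv_into (\<Union>(N ` F)) \<psi>) (\<psi> ` \<Union>(N ` F))"
          using inj by (rule inj_on_the_inv_into)
        show "\<forall>x\<in>\<psi> ` \<Union>(N ` F). the_inv_into (\<Union>(N ` F)) \<psi> x \<in> N x"
          using \<psi> the_inv_into_f_f[OF inj] by (metis (no_types, lifting) imageE)
        show "card F \<le> card (\<psi> ` \<Union>(N ` F)) + k"
          using hall[of F] card_image[OF inj] by simp
      qed
    qed
  qed
  then show thesis using that by blast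
qed

section \<open>From an invariant mean to nearly invariant sets\<close>

lemma finite_matching_cards:
  assumes "finite E"
  shows "finite {card D |D. D \<subseteq> E \<and>
            (\<exists>\<phi>. inj_on \<phi> D \<and> \<phi> ` D \<subseteq> F \<and> (\<forall>x\<in>D. \<exists>U\<in>\<U>. {x, \<phi> x} \<subseteq> U))}"
  by (rule finite_subset[of _ "card ` Pow E"]) (use assms in auto)

lemma matching_number_ge:
  assumes "finite E" "D \<subseteq> E" "inj_on \<phi> D" "\<phi> ` D \<subseteq> F" "\<forall>x\<in>D. \<exists>U\<in>\<U>. {x, \<phi> x} \<subseteq> U"
  shows "card D \<le> matching_number E F \<U>"
  unfolding matching_number_def
  by (rule Max_ge[OF finite_matching_cards[OF assms(1)]]) (use assms in blast)

lemma matching_number_attained: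
  assumes "finite E"
  obtains D \<phi> where "D \<subseteq> E" "inj_on \<phi> D" "\<phi> ` D \<subseteq> F" "\<forall>x\<in>D. \<exists>U\<in>\<U>. {x, \<phi> x} \<subseteq> U"
    "card D = matching_number E F \<U>"
proof -
  define C where "C = {card D |D. D \<subseteq> E \<and>
            (\<exists>\<phi>. inj_on \<phi> D \<and> \<phi> ` D \<subseteq> F \<and> (\<forall>x\<in>D. \<exists>U\<in>\<U>. {x, \<phi> x} \<subseteq> U))}"
  have "card {} \<in> C"
    unfolding C_def
    by (intro CollectI exI[of _ "{}"] exI[of _ "\<lambda>_. undefined"] conjI refl empty_subsetI) simp_all
  then have "Max C \<in> C"
    using Max_in[OF finite_matching_cards[OF assms, of F \<U>, folded C_def]] by blast
  moreover have "Max C = matching_number E F \<U>"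
    by (simp add: C_def matching_number_def)
  ultimately have "matching_number E F \<U> \<in> C" by simp
  then show thesis
    unfolding C_def mem_Collect_eq by (elim exE conjE) (rule that; simp)
qed

text \<open>
  Applied to the family \<open>I\<close> of all members of the covering that meet \<open>S\<close>, the function \<open>q I\<close> counts
  every element of \<open>S\<close> fully and is supported on the points that are neighbours of \<open>S\<close>. Near equality
  of its sums over \<open>F\<close> and \<open>F'\<close> is thus Hall's condition with a defect.
\<close>

lemma matching_number_ge_if_balanced:
  fixes q :: "'a set set \<Rightarrow> 'a \<Rightarrow> real"
  assumes fin: "finite F" "finite F'"
    and q: "\<And>I x. 0 \<le> q I x" "\<And>I x. q I x \<le> 1" "\<And>I x. x \<notin> \<Union>I \<Longrightarrow> q I x = 0"
      "\<And>I x. I \<subseteq> \<U> \<Longrightarrow> {U\<in>\<U>. x \<in> U} \<subseteq> I \<Longrightarrow> q I x = 1"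
    and bal: "\<And>I. I \<subseteq> \<U> \<Longrightarrow> (\<Sum>x\<in>F. q I x) \<le> (\<Sum>y\<in>F'. q I y) + \<delta>"
  shows "real (card F) - \<delta> \<le> real (matching_number F F' \<U>)"
proof -
  define N where "N x = {y\<in>F'. \<exists>U\<in>\<U>. x \<in> U \<and> y \<in> U}" for x
  have "0 \<le> \<delta>" using bal[of "{}"] q(3)[of _ "{}"] by simp
  have hall: "card S \<le> card (\<Union>(N ` S)) + nat \<lfloor>\<delta>\<rfloor>" if "S \<subseteq> F" for S
  proof -
    define I where "I = {U\<in>\<U>. U \<inter> S \<noteq> {}}"
    have "real (card S) = (\<Sum>x\<in>S. q I x)"
    proof -
      have "q I x = 1" if "x \<in> S" for x
        by (rule q(4)) (use that in \<open>auto simp: I_def\<close>)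
      then show ?thesis by simp
    qed
    also have "\<dots> \<le> (\<Sum>x\<in>F. q I x)"
      using fin q(1) that by (intro sum_mono2) auto
    also have "\<dots> \<le> (\<Sum>y\<in>F'. q I y) + \<delta>"
      by (rule bal) (auto simp: I_def)
    also have "(\<Sum>y\<in>F'. q I y) = (\<Sum>y\<in>\<Union>(N ` S). q I y)"
    proof (rule sum.mono_neutral_right[OF fin(2)])
      show "\<forall>y\<in>F' - \<Union>(N ` S). q I y = 0"
        by (intro ballI q(3)) (auto simp: N_def I_def)
    qed (auto simp: N_def)
    also have "\<dots> \<le> (\<Sum>y\<in>\<Union>(N ` S). 1)"
      using q(2) by (intro sum_mono)
    finally have "real (card S) - real (card (\<Union>(N ` S))) \<le> \<delta>" by simp
    then have "int (card S) - int (card (\<Union>(N ` S))) \<le> \<lfloor>\<delta>\<rfloor>"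
      by (simp add: le_floor_iff)
    then show ?thesis by linarith
  qed
  obtain D \<phi> where D: "D \<subseteq> F" "inj_on \<phi> D" "\<And>x. x \<in> D \<Longrightarrow> \<phi> x \<in> N x" "card F \<le> card D + nat \<lfloor>\<delta>\<rfloor>"
    using matching_with_defect[OF fin(1) _ hall] fin(2) by (auto simp: N_def)
  have "card D \<le> matching_number F F' \<U>"
    by (rule matching_number_ge[OF fin(1) D(1,2)]) (use D(3) in \<open>auto simp: N_def\<close>)
  moreover have "real (nat \<lfloor>\<delta>\<rfloor>) \<le> \<delta>"
    using \<open>0 \<le> \<delta>\<close> by simp
  ultimately show ?thesis using D(4) by linarith
qed

lemma matching_condition_if_amenable:
  fixes E :: "'a::topological_group_add set"
  assumes "amenable TYPE('a)" "\<theta> < 1" "finite E" "finite \<U>" "right_uniform_covering \<U>"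
  shows "\<exists>F. finite F \<and> F \<noteq> {} \<and>
          (\<forall>g\<in>E. real (matching_number F ((\<lambda>x. g + x) ` F) \<U>) \<ge> \<theta> * real (card F))"
proof -
  obtain W where W: "0 \<in> interior W" "\<And>x. \<exists>V\<in>\<U>. (\<lambda>u. u + x) ` W \<subseteq> V"
    using assms(5) unfolding right_uniform_covering_def by (elim exE conjE) (rule that; blast)
  have W_x: "x \<in> (\<lambda>u. u + x) ` W" for x
    by (rule image_eqI[of _ _ 0]) (use W(1) interior_subset in auto)
  show ?thesis
  proof (cases "finite (UNIV :: 'a set)")
    case True
    have "\<theta> * real (card (UNIV :: 'a set)) \<le> real (matching_number UNIV (range (\<lambda>x. g + x)) \<U>)" for g
    proof -
      have "\<exists>U\<in>\<U>. {x, id x} \<subseteq> U" for x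
        using W(2)[of x] W_x[of x] by auto
      then have "card (UNIV :: 'a set) \<le> matching_number UNIV (range (\<lambda>x. g + x)) \<U>"
        by (intro matching_number_ge[OF True, of _ id]) (auto simp: surj_plus)
      moreover have "\<theta> * real (card (UNIV :: 'a set)) \<le> 1 * real (card (UNIV :: 'a set))"
        using assms(2) by (intro mult_right_mono) auto
      ultimately show ?thesis by linarith
    qed
    then show ?thesis using True by blast
  next
    case False
    obtain \<nu> :: "('a \<Rightarrow> real) \<Rightarrow> real" where mean: "mean_right \<nu>"
      and inv: "\<And>f g. f \<in> UCb_right \<Longrightarrow> \<nu> (f \<circ> (\<lambda>x. g + x)) = \<nu> f"
      using assms(1) unfolding amenable_def by auto
    have "\<forall>I. \<exists>q. q \<in> UCb_right \<and> (\<forall>x. 0 \<le> q x) \<and> (\<forall>x. q x \<le> 1) \<and> (\<forall>x. x \<notin> \<Union>I \<longrightarrow> q x = 0) \<and>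
        (\<forall>x. (\<lambda>u. u + x) ` W \<subseteq> \<Union>I \<longrightarrow> q x = 1)"
    proof
      fix I :: "'a set set"
      show "\<exists>q. q \<in> UCb_right \<and> (\<forall>x. 0 \<le> q x) \<and> (\<forall>x. q x \<le> 1) \<and> (\<forall>x. x \<notin> \<Union>I \<longrightarrow> q x = 0) \<and>
          (\<forall>x. (\<lambda>u. u + x) ` W \<subseteq> \<Union>I \<longrightarrow> q x = 1)"
        by (rule uniform_Urysohn[OF W(1), of "\<Union>I"]) blast
    qed
    then obtain q where q: "\<And>I. q I \<in> UCb_right" "\<And>I x. 0 \<le> q I x" "\<And>I x. q I x \<le> 1"
      "\<And>I x. x \<notin> \<Union>I \<Longrightarrow> q I x = 0" "\<And>I x. (\<lambda>u. u + x) ` W \<subseteq> \<Union>I \<Longrightarrow> q I x = 1"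
      by metis
    define k where "k g I = (\<lambda>x. (q I \<circ> (\<lambda>x. g + x)) x + (-1) * q I x)" for g I
    define K where "K = (\<lambda>(g, I). k g I) ` (E \<times> Pow \<U>)"
    have "finite K" using assms(3,4) by (simp add: K_def)
    have k_UCb: "k g I \<in> UCb_right" for g I
      unfolding k_def by (intro UCb_right_add UCb_right_translate UCb_right_cmult q)
    have k_null: "\<nu> (k g I) = 0" for g I
    proof -
      have "\<nu> (k g I) = \<nu> (q I \<circ> (\<lambda>x. g + x)) + \<nu> (\<lambda>x. (-1) * q I x)"
        unfolding k_def by (rule mean_right_add[OF mean UCb_right_translate[OF q(1)] UCb_right_cmult[OF q(1)]])
      moreover have "\<nu> (\<lambda>x. (-1) * q I x) = (-1) * \<nu> (q I)"
        by (rule mean_right_cmult[OF mean q(1)])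
      ultimately show ?thesis using inv[OF q(1)] by simp
    qed
    have K: "f \<in> UCb_right" "\<nu> f = 0" if "f \<in> K" for f
      using that k_UCb k_null by (auto simp: K_def)
    have bound: "\<bar>f x\<bar> \<le> 1" if "f \<in> K" for f x
    proof -
      from that obtain g I where "f = k g I" by (auto simp: K_def)
      then show ?thesis
        using q(2,3)[of I x] q(2,3)[of I "g + x"] by (simp add: k_def abs_le_iff)
    qed
    have inf: "infinite {x. (\<Sum>f\<in>K. c f * f x) < 1}" for c
    proof (rule infinite_below_one_if_mean_zero[OF False mean inv])
      have UC: "(\<lambda>x. c f * f x) \<in> UCb_right" if "f \<in> K" for f
        by (rule UCb_right_cmult[OF K(1)[OF that]])
      then show "(\<lambda>x. \<Sum>f\<in>K. c f * f x) \<in> UCb_right"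
        by (rule UCb_right_sum)
      have "\<nu> (\<lambda>x. c f * f x) = 0" if "f \<in> K" for f
        using mean_right_cmult[OF mean K(1)[OF that], of "c f"] K(2)[OF that] by simp
      then show "\<nu> (\<lambda>x. \<Sum>f\<in>K. c f * f x) = 0"
        using mean_right_sum[where I = K and f = "\<lambda>f x. c f * f x", OF mean UC] by simp
    qed
    define \<epsilon> where "\<epsilon> = 1 - \<theta>"
    have "\<epsilon> > 0" using assms(2) by (simp add: \<epsilon>_def)
    \<comment> \<open>for this \<open>n\<close>, a square of at most \<open>(2 + card K) n\<close> comes from a number of at most \<open>\<epsilon> n\<close>\<close>
    obtain n where n: "(2 + real (card K)) / \<epsilon>\<^sup>2 < real n"
      using reals_Archimedean2[of "(2 + real (card K)) / \<epsilon>\<^sup>2"] by auto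
    have "0 \<le> (2 + real (card K)) / \<epsilon>\<^sup>2" by simp
    then have "n > 0"
      using n by linarith
    have "\<exists>F. finite F \<and> card F = n \<and> (\<Sum>f\<in>K. (\<Sum>x\<in>F. f x)\<^sup>2) \<le> (2 + real (card K)) * real n"
      by (rule balanced_set_exists[OF \<open>finite K\<close>]) (fact bound, fact inf)
    then obtain F where F: "finite F" "card F = n"
      "(\<Sum>f\<in>K. (\<Sum>x\<in>F. f x)\<^sup>2) \<le> (2 + real (card K)) * real n"
      by blast
    have bal: "\<bar>\<Sum>x\<in>F. f x\<bar> \<le> \<epsilon> * real n" if "f \<in> K" for f
    proof (rule power2_le_imp_le)
      have "\<bar>\<Sum>x\<in>F. f x\<bar>\<^sup>2 \<le> (\<Sum>f\<in>K. (\<Sum>x\<in>F. f x)\<^sup>2)"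
        using member_le_sum[OF that, of "\<lambda>f. (\<Sum>x\<in>F. f x)\<^sup>2"] \<open>finite K\<close> by simp
      also have "\<dots> \<le> (2 + real (card K)) * real n" by (rule F(3))
      also have "\<dots> \<le> (real n * \<epsilon>\<^sup>2) * real n"
        using n \<open>\<epsilon> > 0\<close> by (intro mult_right_mono) (simp_all add: pos_divide_less_eq less_imp_le)
      also have "\<dots> = (\<epsilon> * real n)\<^sup>2" by (simp add: power2_eq_square)
      finally show "\<bar>\<Sum>x\<in>F. f x\<bar>\<^sup>2 \<le> (\<epsilon> * real n)\<^sup>2" .
    qed (use \<open>\<epsilon> > 0\<close> in simp)
    have "\<theta> * real (card F) \<le> real (matching_number F ((\<lambda>x. g + x) ` F) \<U>)" if "g \<in> E" for g
    proof -
      have "real (card F) - \<epsilon> * real n \<le> real (matching_number F ((\<lambda>x. g + x) ` F) \<U>)"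
      proof (rule matching_number_ge_if_balanced[of _ _ q])
        show "q I x = 1" if I: "I \<subseteq> \<U>" "{U\<in>\<U>. x \<in> U} \<subseteq> I" for I x
        proof (rule q(5))
          obtain V where V: "V \<in> \<U>" "(\<lambda>u. u + x) ` W \<subseteq> V" using W(2)[of x] by blast
          moreover have "V \<in> I" using V W_x[of x] I(2) by auto
          ultimately show "(\<lambda>u. u + x) ` W \<subseteq> \<Union>I" by blast
        qed
        show "(\<Sum>x\<in>F. q I x) \<le> (\<Sum>y\<in>(\<lambda>x. g + x) ` F. q I y) + \<epsilon> * real n" if "I \<subseteq> \<U>" for I
        proof -
          have "k g I \<in> K" using that \<open>g \<in> E\<close> by (auto simp: K_def)
          then have "- (\<Sum>x\<in>F. k g I x) \<le> \<epsilon> * real n"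
            using bal[of "k g I"] by linarith
          moreover have "(\<Sum>y\<in>(\<lambda>x. g + x) ` F. q I y) = (\<Sum>x\<in>F. q I (g + x))"
            by (subst sum.reindex) (auto simp: inj_on_def)
          ultimately show ?thesis
            by (simp add: k_def sum.distrib sum_negf sum_subtractf)
        qed
      qed (use F(1) q(2-4) in simp_all)
      then show ?thesis using F(2) by (simp add: \<epsilon>_def algebra_simps)
    qed
    then show ?thesis using F \<open>n > 0\<close> by (intro exI[of _ F]) auto
  qed
qed

section \<open>From nearly invariant sets to an invariant mean\<close>

text \<open>
  Round all values of the functions in \<open>H\<close> down to multiples of \<open>e = \<delta>/4\<close>. By boundedness only
  finitely many vectors of rounded values occur. The member of the covering for such a vector
  consists of the points whose values are within \<open>2e\<close> of it: one \<open>e\<close> for rounding, and another to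
  leave room for the variation of the functions on a small translated neighbourhood.
\<close>

lemma finite_covering_with_small_oscillation:
  fixes H :: "('a::topological_group_add \<Rightarrow> real) set"
  assumes "finite H" "H \<subseteq> UCb_right" "\<delta> > 0"
  obtains \<U> where "finite \<U>" "right_uniform_covering \<U>"
    "\<And>U x y f. U \<in> \<U> \<Longrightarrow> x \<in> U \<Longrightarrow> y \<in> U \<Longrightarrow> f \<in> H \<Longrightarrow> \<bar>f x - f y\<bar> \<le> \<delta>"
proof -
  define e where "e = \<delta> / 4"
  have "e > 0" using assms(3) by (simp add: e_def)
  define C :: "(('a \<Rightarrow> real) \<Rightarrow> int) \<Rightarrow> 'a set"
    where "C c = {y. \<forall>f\<in>H. \<bar>f y - e * of_int (c f)\<bar> \<le> 2 * e}" for c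
  define level where "level x = (\<lambda>f\<in>H. \<lfloor>f x / e\<rfloor>)" for x :: 'a
  have near: "\<bar>f x - e * of_int (level x f)\<bar> \<le> e" if "f \<in> H" for f x
  proof -
    have "e * of_int \<lfloor>f x / e\<rfloor> \<le> e * (f x / e)" "e * (f x / e) \<le> e * (of_int \<lfloor>f x / e\<rfloor> + 1)"
      using \<open>e > 0\<close> by (intro mult_left_mono; linarith)+
    then show ?thesis
      using that \<open>e > 0\<close> by (simp add: level_def algebra_simps abs_le_iff)
  qed
  have "finite (range level)"
  proof (rule finite_subset)
    show "finite (\<Pi>\<^sub>E f\<in>H. range (\<lambda>x. \<lfloor>f x / e\<rfloor>))"
    proof (rule finite_PiE[OF assms(1)])
      fix f assume "f \<in> H"
      then have "f \<in> UCb_right" using assms(2) by auto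
      then obtain B where B: "B > 0" "\<And>x. \<bar>f x\<bar> \<le> B"
        by (rule UCb_right_bound) blast
      have "\<lfloor>f x / e\<rfloor> \<in> {\<lfloor>- B / e\<rfloor>..\<lfloor>B / e\<rfloor>}" for x
      proof -
        have "- B / e \<le> f x / e" "f x / e \<le> B / e"
          using B(2)[of x] \<open>e > 0\<close> by (intro divide_right_mono; linarith)+
        then show ?thesis by (simp add: floor_mono)
      qed
      then show "finite (range (\<lambda>x. \<lfloor>f x / e\<rfloor>))"
        by (intro finite_subset[OF _ finite_atLeastAtMost_int]) blast
    qed
    show "range level \<subseteq> (\<Pi>\<^sub>E f\<in>H. range (\<lambda>x. \<lfloor>f x / e\<rfloor>))"
      by (auto simp: level_def)
  qed
  then have fin: "finite (C ` range level)" by (rule finite_imageI)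
  have "\<exists>U. 0 \<in> interior U \<and> (\<forall>x y. x - y \<in> U \<longrightarrow> \<bar>f x - f y\<bar> \<le> e)" if "f \<in> H" for f
    using that assms(2) \<open>e > 0\<close> unfolding UCb_right_def right_uniformly_continuous_def by blast
  then obtain U where U: "\<And>f. f \<in> H \<Longrightarrow> 0 \<in> interior (U f)"
    "\<And>f x y. f \<in> H \<Longrightarrow> x - y \<in> U f \<Longrightarrow> \<bar>f x - f y\<bar> \<le> e"
    by metis
  define W where "W = (\<Inter>f\<in>H. interior (U f))"
  have "open W" "0 \<in> W"
    using assms(1) U(1) by (auto simp: W_def)
  have "(\<lambda>u. u + x) ` W \<subseteq> C (level x)" for x
  proof -
    have "\<bar>f (u + x) - e * of_int (level x f)\<bar> \<le> 2 * e" if "u \<in> W" "f \<in> H" for u f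
    proof -
      have "(u + x) - x \<in> U f"
        using that interior_subset by (auto simp: W_def)
      then show ?thesis
        using U(2)[OF that(2)] near[OF that(2), of x] by fastforce
    qed
    then show ?thesis by (auto simp: C_def)
  qed
  then have cov: "right_uniform_covering (C ` range level)"
    unfolding right_uniform_covering_def using \<open>open W\<close> \<open>0 \<in> W\<close>
    by (intro exI[of _ W]) (auto simp: interior_open)
  have "\<bar>f x - f y\<bar> \<le> \<delta>" if "x \<in> C c" "y \<in> C c" "f \<in> H" for x y f c
  proof -
    have "\<bar>f x - e * of_int (c f)\<bar> \<le> 2 * e" "\<bar>f y - e * of_int (c f)\<bar> \<le> 2 * e"
      using that by (auto simp: C_def)
    then have "\<bar>f x - f y\<bar> \<le> 4 * e" by linarith
    then show ?thesis by (simp add: e_def)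
  qed
  with fin cov show thesis
    by (intro that[of "C ` range level"]) auto
qed

text \<open>
  Matched pairs contribute at most \<open>\<delta>\<close> each; the unmatched elements on either side contribute at
  most \<open>B\<close> each, and both sides have equally many of them.
\<close>

lemma sum_diff_le_if_matched:
  fixes f :: "'a \<Rightarrow> real"
  assumes "finite F" "finite F'" "card F' = card F"
    and D: "D \<subseteq> F" "inj_on \<phi> D" "\<phi> ` D \<subseteq> F'"
    and near: "\<And>x. x \<in> D \<Longrightarrow> \<bar>f x - f (\<phi> x)\<bar> \<le> \<delta>" and bound: "\<And>x. \<bar>f x\<bar> \<le> B"
  shows "\<bar>(\<Sum>y\<in>F'. f y) - (\<Sum>x\<in>F. f x)\<bar> \<le> \<delta> * card D + 2 * B * (real (card F) - real (card D))"
proof -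
  have rest: "\<bar>\<Sum>x\<in>A - D'. f x\<bar> \<le> B * (real (card A) - real (card D'))"
    if "finite A" "D' \<subseteq> A" for A D'
  proof -
    have "\<bar>\<Sum>x\<in>A - D'. f x\<bar> \<le> (\<Sum>x\<in>A - D'. B)"
      by (rule order_trans[OF sum_abs sum_mono]) (rule bound)
    also have "\<dots> = B * (real (card A) - real (card D'))"
      using that by (simp add: card_Diff_subset finite_subset of_nat_diff card_mono)
    finally show ?thesis .
  qed
  have "(\<Sum>y\<in>F'. f y) = (\<Sum>y\<in>F' - \<phi> ` D. f y) + (\<Sum>x\<in>D. f (\<phi> x))"
    using sum.subset_diff[OF D(3) assms(2), of f] sum.reindex[OF D(2), of f] by simp
  moreover have "(\<Sum>x\<in>F. f x) = (\<Sum>x\<in>F - D. f x) + (\<Sum>x\<in>D. f x)"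
    by (rule sum.subset_diff[OF D(1) assms(1)])
  moreover have "\<bar>(\<Sum>x\<in>D. f x) - (\<Sum>x\<in>D. f (\<phi> x))\<bar> \<le> \<delta> * card D"
  proof -
    have "\<bar>\<Sum>x\<in>D. f x - f (\<phi> x)\<bar> \<le> (\<Sum>x\<in>D. \<delta>)"
      by (rule order_trans[OF sum_abs sum_mono]) (rule near)
    then show ?thesis by (simp add: sum_subtractf mult.commute)
  qed
  moreover have "card (\<phi> ` D) = card D" by (rule card_image[OF D(2)])
  ultimately show ?thesis
    using rest[OF assms(1) D(1)] rest[OF assms(2) D(3)] assms(3) by (simp add: algebra_simps)
qed

definition matching_condition :: "'a::topological_group_add itself \<Rightarrow> bool" where
  "matching_condition _ \<longleftrightarrow> (\<forall>\<theta>::real. \<forall>E :: 'a set. \<forall>\<U> :: 'a set set.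
       0 \<le> \<theta> \<and> \<theta> < 1 \<and> finite E \<and> finite \<U> \<and> right_uniform_covering \<U> \<longrightarrow>
       (\<exists>F. finite F \<and> F \<noteq> {} \<and>
          (\<forall>g\<in>E. real (matching_number F ((\<lambda>x. g + x) ` F) \<U>) \<ge> \<theta> * real (card F))))"

lemma nearly_invariant_set_exists:
  fixes H :: "('a::topological_group_add \<Rightarrow> real) set"
  assumes "matching_condition TYPE('a)" "finite E" "finite H" "H \<subseteq> UCb_right" "\<epsilon> > 0"
  obtains F where "finite F" "F \<noteq> {}"
    "\<And>g f. g \<in> E \<Longrightarrow> f \<in> H \<Longrightarrow> \<bar>(\<Sum>x\<in>F. f (g + x)) - (\<Sum>x\<in>F. f x)\<bar> \<le> \<epsilon> * real (card F)"
proof -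
  have "\<exists>b. \<forall>x. \<bar>f x\<bar> \<le> b" if "f \<in> H" for f
    by (rule UCb_right_bound[of f]) (use that assms(4) in auto)
  then obtain b where b: "\<And>f x. f \<in> H \<Longrightarrow> \<bar>f x\<bar> \<le> b f" by metis
  define B where "B = 1 + (\<Sum>f\<in>H. \<bar>b f\<bar>)"
  have "B > 0" unfolding B_def by (intro add_pos_nonneg sum_nonneg) auto
  have B: "\<bar>f x\<bar> \<le> B" if "f \<in> H" for f x
    using b[OF that, of x] member_le_sum[OF that, of "\<lambda>f. \<bar>b f\<bar>"] assms(3) by (simp add: B_def)
  \<comment> \<open>half of \<open>\<epsilon>\<close> is spent on matched pairs, the other half on the unmatched elements\<close>
  define \<theta> where "\<theta> = max 0 (1 - \<epsilon> / (4 * B))"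
  have \<theta>: "0 \<le> \<theta>" "\<theta> < 1" "2 * B * (1 - \<theta>) \<le> \<epsilon> / 2"
  proof -
    show "0 \<le> \<theta>" "\<theta> < 1" using \<open>B > 0\<close> assms(5) by (auto simp: \<theta>_def)
    have "2 * B * (1 - \<theta>) \<le> 2 * B * (\<epsilon> / (4 * B))"
      using \<open>B > 0\<close> by (intro mult_left_mono) (auto simp: \<theta>_def)
    then show "2 * B * (1 - \<theta>) \<le> \<epsilon> / 2" using \<open>B > 0\<close> by simp
  qed
  obtain \<U> where U: "finite \<U>" "right_uniform_covering \<U>"
    "\<And>U x y f. U \<in> \<U> \<Longrightarrow> x \<in> U \<Longrightarrow> y \<in> U \<Longrightarrow> f \<in> H \<Longrightarrow> \<bar>f x - f y\<bar> \<le> \<epsilon> / 2"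
    by (rule finite_covering_with_small_oscillation[of H "\<epsilon> / 2"]) (use assms in auto)
  obtain F where F: "finite F" "F \<noteq> {}"
    "\<And>g. g \<in> E \<Longrightarrow> \<theta> * real (card F) \<le> real (matching_number F ((\<lambda>x. g + x) ` F) \<U>)"
    using assms(1,2) U(1,2) \<theta>(1,2) unfolding matching_condition_def by metis
  show thesis
  proof (rule that[OF F(1,2)])
    fix g f assume "g \<in> E" "f \<in> H"
    let ?F' = "(\<lambda>x. g + x) ` F"
    have inj: "inj_on (\<lambda>x. g + x) F" by (simp add: inj_on_def)
    obtain D \<phi> where D: "D \<subseteq> F" "inj_on \<phi> D" "\<phi> ` D \<subseteq> ?F'" "\<forall>x\<in>D. \<exists>U\<in>\<U>. {x, \<phi> x} \<subseteq> U"
      "card D = matching_number F ?F' \<U>"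
      by (rule matching_number_attained[OF F(1)])
    have "\<bar>(\<Sum>y\<in>?F'. f y) - (\<Sum>x\<in>F. f x)\<bar> \<le> \<epsilon> / 2 * card D + 2 * B * (real (card F) - real (card D))"
    proof (rule sum_diff_le_if_matched[OF F(1) _ _ D(1-3)])
      show "finite ?F'" using F(1) by simp
      show "card ?F' = card F" by (rule card_image[OF inj])
      show "\<bar>f x - f (\<phi> x)\<bar> \<le> \<epsilon> / 2" if "x \<in> D" for x
        using D(4) that U(3) \<open>f \<in> H\<close> by auto
      show "\<bar>f x\<bar> \<le> B" for x by (rule B[OF \<open>f \<in> H\<close>])
    qed
    also have "\<epsilon> / 2 * card D \<le> \<epsilon> / 2 * card F"
      using assms(5) card_mono[OF F(1) D(1)] by (intro mult_left_mono) auto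
    also have "2 * B * (real (card F) - real (card D)) \<le> 2 * B * ((1 - \<theta>) * real (card F))"
      using F(3)[OF \<open>g \<in> E\<close>] D(5) \<open>B > 0\<close> by (intro mult_left_mono) (auto simp: algebra_simps)
    also have "\<dots> \<le> \<epsilon> / 2 * real (card F)"
      using mult_right_mono[OF \<theta>(3), of "real (card F)"] by (simp add: mult.assoc)
    finally have "\<bar>(\<Sum>y\<in>?F'. f y) - (\<Sum>x\<in>F. f x)\<bar> \<le> \<epsilon> * real (card F)" by simp
    moreover have "(\<Sum>y\<in>?F'. f y) = (\<Sum>x\<in>F. f (g + x))"
      by (simp add: sum.reindex[OF inj])
    ultimately show "\<bar>(\<Sum>x\<in>F. f (g + x)) - (\<Sum>x\<in>F. f x)\<bar> \<le> \<epsilon> * real (card F)" by simp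
  qed
qed

text \<open>
  Prescribing the value \<open>0\<close> outside \<^const>\<open>UCb_right\<close> confines every coordinate to a compact
  set, which makes Tychonoff's theorem applicable.
\<close>

definition normalized_means :: "(('a::topological_group_add \<Rightarrow> real) \<Rightarrow> real) set" where
  "normalized_means = {\<nu>. mean_right \<nu> \<and> (\<forall>f. f \<notin> UCb_right \<longrightarrow> \<nu> f = 0)}"

lemma compact_normalized_means:
  "compact (normalized_means :: (('a::topological_group_add \<Rightarrow> real) \<Rightarrow> real) set)"
proof -
  define R :: "('a \<Rightarrow> real) \<Rightarrow> real set"
    where "R f = (if f \<in> UCb_right then {INF x. f x..SUP x. f x} else {0})" for f
  have "compactin (product_topology (\<lambda>_. euclidean) UNIV) (Pi\<^sub>E UNIV R)"
    unfolding compactin_PiE by (auto simp: R_def)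
  then have cpt: "compact (Pi\<^sub>E UNIV R)"
    by (simp add: euclidean_product_topology)
  have "closed {\<nu> :: ('a \<Rightarrow> real) \<Rightarrow> real.
      (\<forall>f. f \<in> UCb_right \<longrightarrow> (\<forall>h. h \<in> UCb_right \<longrightarrow> \<nu> (\<lambda>x. f x + h x) = \<nu> f + \<nu> h)) \<and>
      (\<forall>c f. f \<in> UCb_right \<longrightarrow> \<nu> (\<lambda>x. c * f x) = c * \<nu> f)}"
    by (intro closed_Collect_conj closed_Collect_all closed_Collect_imp open_Collect_const
        closed_Collect_eq continuous_intros continuous_on_product_coordinates)
  then have "compact (Pi\<^sub>E UNIV R \<inter> {\<nu> :: ('a \<Rightarrow> real) \<Rightarrow> real.
      (\<forall>f. f \<in> UCb_right \<longrightarrow> (\<forall>h. h \<in> UCb_right \<longrightarrow> \<nu> (\<lambda>x. f x + h x) = \<nu> f + \<nu> h)) \<and>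
      (\<forall>c f. f \<in> UCb_right \<longrightarrow> \<nu> (\<lambda>x. c * f x) = c * \<nu> f)})" (is "compact ?K")
    by (rule compact_Int_closed[OF cpt])
  also have "?K = normalized_means"
    by (auto simp: normalized_means_def mean_right_def PiE_iff R_def split: if_splits)
  finally show ?thesis .
qed

lemma average_in_normalized_means:
  fixes F :: "'a::topological_group_add set"
  assumes "finite F" "F \<noteq> {}"
  shows "(\<lambda>f. if f \<in> UCb_right then (\<Sum>x\<in>F. f x) / real (card F) else 0) \<in> normalized_means"
proof -
  have pos: "real (card F) > 0" using assms by (simp add: card_gt_0_iff)
  have bounds: "(INF x. f x) \<le> (\<Sum>x\<in>F. f x) / real (card F) \<and>
      (\<Sum>x\<in>F. f x) / real (card F) \<le> (SUP x. f x)" if "f \<in> UCb_right" for f :: "'a \<Rightarrow> real"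
  proof -
    have bdd: "bdd_below (range f)" "bdd_above (range f)"
      using that by (auto simp: UCb_right_def bounded_imp_bdd_below bounded_imp_bdd_above)
    have "(\<Sum>x\<in>F. INF x. f x) \<le> (\<Sum>x\<in>F. f x)" "(\<Sum>x\<in>F. f x) \<le> (\<Sum>x\<in>F. SUP x. f x)"
      by (intro sum_mono cINF_lower[OF bdd(1)] cSUP_upper[OF _ bdd(2)] UNIV_I)+
    then show ?thesis
      using pos by (simp add: pos_le_divide_eq pos_divide_le_eq mult.commute)
  qed
  show ?thesis
    unfolding normalized_means_def mean_right_def
    using bounds
    by (auto simp: UCb_right_add UCb_right_cmult sum.distrib add_divide_distrib sum_distrib_left[symmetric])
qed

text \<open>
  Approximate invariance up to \<open>\<epsilon>\<close> for one function and one group element is a closed condition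
  on means. Finitely many such conditions are met by the average over a nearly invariant set, hence
  by compactness all of them are met simultaneously.
\<close>

lemma amenable_if_matching_condition:
  assumes "matching_condition TYPE('a::topological_group_add)"
  shows "amenable TYPE('a)"
proof -
  define T where "T = {(f :: 'a \<Rightarrow> real, g :: 'a, \<epsilon> :: real). f \<in> UCb_right \<and> \<epsilon> > 0}"
  define A where "A = (\<lambda>(f :: 'a \<Rightarrow> real, g, \<epsilon>). {\<nu> :: ('a \<Rightarrow> real) \<Rightarrow> real.
     \<bar>\<nu> (f \<circ> (\<lambda>x. g + x)) - \<nu> f\<bar> \<le> \<epsilon>})"
  have "normalized_means \<inter> (\<Inter>t\<in>T. A t) \<noteq> {}"
  proof (rule compact_imp_fip_image[OF compact_normalized_means])
    fix t assume "t \<in> T"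
    show "closed (A t)"
      unfolding A_def split_beta
      by (intro closed_Collect_le continuous_intros continuous_on_product_coordinates)
  next
    fix T' assume T': "finite T'" "T' \<subseteq> T"
    define \<epsilon> where "\<epsilon> = Min (insert 1 ((\<lambda>(f, g, \<epsilon>). \<epsilon>) ` T'))"
    have "\<epsilon> > 0"
      unfolding \<epsilon>_def using T' by (subst Min_gr_iff) (auto simp: T_def)
    obtain F where F: "finite F" "F \<noteq> {}"
      "\<And>g f. g \<in> (\<lambda>(f, g, \<epsilon>). g) ` T' \<Longrightarrow> f \<in> (\<lambda>(f, g, \<epsilon>). f) ` T' \<Longrightarrow>
         \<bar>(\<Sum>x\<in>F. f (g + x)) - (\<Sum>x\<in>F. f x)\<bar> \<le> \<epsilon> * real (card F)"
      by (rule nearly_invariant_set_exists[OF assms _ _ _ \<open>\<epsilon> > 0\<close>,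
            of "(\<lambda>(f, g, \<epsilon>). g) ` T'" "(\<lambda>(f, g, \<epsilon>). f) ` T'"])
         (use T' in \<open>auto simp: T_def\<close>)
    define m :: "('a \<Rightarrow> real) \<Rightarrow> real"
      where "m f = (if f \<in> UCb_right then (\<Sum>x\<in>F. f x) / real (card F) else 0)" for f
    have "m \<in> normalized_means"
      unfolding m_def by (rule average_in_normalized_means[OF F(1,2)])
    moreover have "m \<in> A t" if "t \<in> T'" for t
    proof -
      obtain f g e where t: "t = (f, g, e)" by (cases t)
      have f: "f \<in> UCb_right" using that T' t by (auto simp: T_def)
      have pos: "real (card F) > 0" using F by (simp add: card_gt_0_iff)
      have "g \<in> (\<lambda>(f, g, \<epsilon>). g) ` T'" "f \<in> (\<lambda>(f, g, \<epsilon>). f) ` T'"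
        using that t by force+
      then have "\<bar>(\<Sum>x\<in>F. f (g + x)) - (\<Sum>x\<in>F. f x)\<bar> \<le> \<epsilon> * real (card F)"
        by (rule F(3))
      also have "\<dots> \<le> e * real (card F)"
      proof (rule mult_right_mono)
        show "\<epsilon> \<le> e"
          unfolding \<epsilon>_def using T'(1) that t by (intro Min_le) force+
      qed simp
      finally have "\<bar>(\<Sum>x\<in>F. f (g + x)) - (\<Sum>x\<in>F. f x)\<bar> \<le> e * real (card F)" .
      moreover have "m (f \<circ> (\<lambda>x. g + x)) - m f = ((\<Sum>x\<in>F. f (g + x)) - (\<Sum>x\<in>F. f x)) / real (card F)"
        using f UCb_right_translate[OF f, of g] by (simp add: m_def diff_divide_distrib)
      ultimately have "\<bar>m (f \<circ> (\<lambda>x. g + x)) - m f\<bar> \<le> e"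
        using pos by (simp add: pos_divide_le_eq)
      then show ?thesis by (simp add: A_def t)
    qed
    ultimately show "normalized_means \<inter> (\<Inter>t\<in>T'. A t) \<noteq> {}" by blast
  qed
  then obtain \<nu> where \<nu>: "\<nu> \<in> normalized_means" "\<And>t. t \<in> T \<Longrightarrow> \<nu> \<in> A t" by blast
  have "\<nu> (f \<circ> (\<lambda>x. g + x)) = \<nu> f" if "f \<in> UCb_right" for f g
  proof -
    have "\<bar>\<nu> (f \<circ> (\<lambda>x. g + x)) - \<nu> f\<bar> \<le> 0 + \<epsilon>" if "\<epsilon> > 0" for \<epsilon>
      using \<nu>(2)[of "(f, g, \<epsilon>)"] that \<open>f \<in> UCb_right\<close> by (simp add: T_def A_def)
    then have "\<bar>\<nu> (f \<circ> (\<lambda>x. g + x)) - \<nu> f\<bar> \<le> 0"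
      by (rule field_le_epsilon)
    then show ?thesis by simp
  qed
  then show ?thesis
    using \<nu>(1) unfolding amenable_def normalized_means_def by blast
qed

theorem theorem6p1:
  shows "amenable TYPE('a::{topological_group_add, t2_space}) \<longleftrightarrow>
    (\<forall>\<theta>::real. \<forall>E :: 'a set. \<forall>\<U> :: 'a set set.
       0 \<le> \<theta> \<and> \<theta> < 1 \<and> finite E \<and> finite \<U> \<and> right_uniform_covering \<U> \<longrightarrow>
       (\<exists>F. finite F \<and> F \<noteq> {} \<and>
          (\<forall>g\<in>E. real (matching_number F ((\<lambda>x. g + x) ` F) \<U>) \<ge> \<theta> * real (card F))))"
  using matching_condition_if_amenable[where 'a = 'a]
    amenable_if_matching_condition[where 'a = 'a, unfolded matching_condition_def]
  by (intro iffI) auto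

end
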